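(* Let $\mathcal{A}$ be an $n$-arc in $\mathrm{PG}(2,q)$, and let $i_1,\ldots,i_m$ ($m\ge 1$) be the distinct integers $i>0$ with $c_i\ne 0$; both cases $c_0=0$ and $c_0\ne 0$ are possible. Let $\mathcal{C}$ be an $[n,n-3,4]_q$ MDS code corresponding to $\mathcal{A}$. Then the following holds. (i) $\mathcal{C}$ has $n(q-1)$ cosets $\mathcal{V}^{(1)}$ of weight $1$, each with the weight distribution $$B_0(\mathcal{V}^{(1)})=B_2(\mathcal{V}^{(1)})=0,\quad B_1(\mathcal{V}^{(1)})=1,\quad B_3(\mathcal{V}^{(1)})=\binom{n-1}{3},$$ $$B_w(\mathcal{V}^{(1)})=A_w(\mathcal{C})-\Omega_w^{(0)}(n,4)+\Omega_w^{(1)}(n,4)\ \text{ if } w=4,5,\ldots,n.$$ (ii) The weight $2$ cosets $\mathcal{V}^{(2)}$ of $\mathcal{C}$ can be partitioned into $m$ classes so that the $j$-th class consists of $(q-1)c_{i_j}$ cosets with the weight distribution $$B_0(\mathcal{V}^{(2)})=B_1(\mathcal{V}^{(2)})=0,\quad B_2(\mathcal{V}^{(2)})=i_j,$$ $$B_w(\mathcal{V}^{(2)})=A_w(\mathcal{C})-\Omega_w^{(0)}(n,4)+(-1)^w\binom{n-2}{n-w}\,i_j\ \text{ if } w=3,4,\ldots,n.$$ Moreover, if $m>1$, then for cosets $\mathcal{V}_a^{(2)},\mathcal{V}_b^{(2)}$ in distinct classes, $$(-1)^{n}B_w(\mathcal{V}_a^{(2)})-B_{n+2-w}(\mathcal{V}_a^{(2)})=(-1)^{n}B_w(\mathcal{V}_b^{(2)})-B_{n+2-w}(\mathcal{V}_b^{(2)}),\quad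 w=3,4,\ldots,n.$$ (iii) If $c_0=0$, then $\mathcal{A}$ is complete, $\mathcal{C}$ has covering radius $2$, and there are no weight $3$ cosets. If $c_0\ne 0$, then $\mathcal{A}$ is incomplete, $\mathcal{C}$ has covering radius $3$, and $\mathcal{C}$ has $(q-1)c_0$ cosets $\mathcal{V}^{(3)}$ of weight $3$, each with the weight distribution $$B_0(\mathcal{V}^{(3)})=B_1(\mathcal{V}^{(3)})=B_2(\mathcal{V}^{(3)})=0,\quad B_3(\mathcal{V}^{(3)})=\binom{n}{3},$$ $$B_w(\mathcal{V}^{(3)})=A_w(\mathcal{C})-\Omega_w^{(0)}(n,4)\ \text{ if } w=4,5,\ldots,n.$$
   Context: An $n$-arc in $\mathrm{PG}(2,q)$ is a set of $n$ points no three of which are collinear; it is complete if it is not contained in an $(n+1)$-arc. A bisecant of an arc is a line meeting it in exactly two points. For the arc $\mathcal{A}$, $c_i$ denotes the number of points of $\mathrm{PG}(2,q)$ not on $\mathcal{A}$ that lie on exactly $i$ bisecants of $\mathcal{A}$. An $[n,n-3,4]_q$ MDS code $\mathcal{C}$ (a linear code of length $n$, dimension $n-3$, minimum distance $4$) corresponds to $\mathcal{A}$ if it has a $3\times n$ parity check matrix whose columns are the points of $\mathcal{A}$ in homogeneous coordinates. The covering radius of a code is the least $R$ such that every vector of $\mathbb{F}_q^n$ is within Hamming distance $R$ of some codeword. A coset of $\mathcal{C}$ is a translate $\mathcal{C}+\mathbf{v}$; its weight is the smallest Hamming weight of a vector in it. $A_w(\mathcal{C})$ (resp. $B_w(\mathcal{V})$)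 is the number of vectors of Hamming weight $w$ in $\mathcal{C}$ (resp. in the coset $\mathcal{V}$). Notation: $\Omega_w^{(v)}(n,d)=(-1)^{w-d}\binom{n-v}{w-v}\binom{w-1-v}{d-2-v}$. *)

theory Defs
  imports "HOL-Analysis.Analysis" "HOL-Library.Disjoint_Sets"
begin

section \<open>The projective plane over a finite field\<close>

text \<open>The plane is built over the field \<^typ>\<open>'a\<close>, so that q is \<^term>\<open>CARD('a)\<close>.  Points and lines
  are the subspaces of dimension 1 and 2 of the three-dimensional vector space; incidence is
  inclusion.\<close>

type_synonym 'a subsp3 = "('a ^ 3) set"

definition pg_points :: "'a::field subsp3 set" where
  "pg_points = {P. vec.subspace P \<and> vec.dim P = 1}"

definition pg_lines :: "'a::field subsp3 set" where
  "pg_lines = {L. vec.subspace L \<and> vec.dim L = 2}"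

definition pg_collinear :: "'a::field subsp3 set \<Rightarrow> bool" where
  "pg_collinear S \<longleftrightarrow> (\<exists>L\<in>pg_lines. \<forall>P\<in>S. P \<subseteq> L)"

definition pg_arc :: "nat \<Rightarrow> 'a::{field,finite} subsp3 set \<Rightarrow> bool" where
  "pg_arc n A \<longleftrightarrow> A \<subseteq> pg_points \<and> card A = n \<and>
     (\<forall>S\<subseteq>A. card S = 3 \<longrightarrow> \<not> pg_collinear S)"

definition pg_complete_arc :: "nat \<Rightarrow> 'a::{field,finite} subsp3 set \<Rightarrow> bool" where
  "pg_complete_arc n A \<longleftrightarrow> pg_arc n A \<and> \<not> (\<exists>A'. pg_arc (n + 1) A' \<and> A \<subseteq> A')"

definition bisecants :: "'a::{field,finite} subsp3 set \<Rightarrow> 'a subsp3 set" where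
  "bisecants A = {L\<in>pg_lines. card {P\<in>A. P \<subseteq> L} = 2}"

definition bisecant_count :: "'a::{field,finite} subsp3 set \<Rightarrow> nat \<Rightarrow> nat" where
  "bisecant_count A i = card {P \<in> pg_points - A. card {L\<in>bisecants A. P \<subseteq> L} = i}"

section \<open>Linear codes\<close>

text \<open>The coordinates of a word are indexed by a finite type \<^typ>\<open>'n\<close>, so the length is
  \<^term>\<open>CARD('n)\<close>.\<close>

definition hamming_weight :: "'a::field ^ 'n \<Rightarrow> nat" where
  "hamming_weight x = card {j. x $ j \<noteq> 0}"

definition hamming_dist :: "'a::field ^ 'n \<Rightarrow> 'a ^ 'n \<Rightarrow> nat" where
  "hamming_dist x y = card {j. x $ j \<noteq> y $ j}"

text \<open>Minimum distance is a relation because a code with a single word has none.\<close>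

definition has_min_distance :: "('a::field ^ 'n) set \<Rightarrow> nat \<Rightarrow> bool" where
  "has_min_distance C d \<longleftrightarrow>
     (\<exists>x\<in>C. \<exists>y\<in>C. x \<noteq> y \<and> hamming_dist x y = d) \<and>
     (\<forall>x\<in>C. \<forall>y\<in>C. x \<noteq> y \<longrightarrow> d \<le> hamming_dist x y)"

definition linear_code :: "nat \<Rightarrow> nat \<Rightarrow> nat \<Rightarrow> ('a::{field,finite} ^ 'n) set \<Rightarrow> bool" where
  "linear_code n k d C \<longleftrightarrow>
     CARD('n) = n \<and> vec.subspace C \<and> vec.dim C = k \<and> has_min_distance C d"

definition MDS_code :: "nat \<Rightarrow> nat \<Rightarrow> nat \<Rightarrow> ('a::{field,finite} ^ 'n) set \<Rightarrow> bool" where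
  "MDS_code n k d C \<longleftrightarrow> linear_code n k d C \<and> d = n - k + 1"

text \<open>The rank of a parity check matrix need not be prescribed: if the null space of a matrix
  with r rows has codimension r, then the rows are linearly independent.\<close>

definition code_corresponds_to_arc ::
    "('a::{field,finite} ^ 'n) set \<Rightarrow> 'a subsp3 set \<Rightarrow> bool" where
  "code_corresponds_to_arc C A \<longleftrightarrow>
     (\<exists>H :: 'a ^ 'n ^ 3. C = {x. H *v x = 0} \<and>
        bij_betw (\<lambda>j. vec.span {column j H}) UNIV A)"

definition covering_radius :: "('a::{field,finite} ^ 'n) set \<Rightarrow> nat" where
  "covering_radius C = (LEAST R. \<forall>v. \<exists>c\<in>C. hamming_dist v c \<le> R)"

definition code_cosets :: "('a::{field,finite} ^ 'n) set \<Rightarrow> ('a ^ 'n) set set" where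
  "code_cosets C = range (\<lambda>v. (\<lambda>c. c + v) ` C)"

definition coset_weight :: "('a::{field,finite} ^ 'n) set \<Rightarrow> nat" where
  "coset_weight V = Min (hamming_weight ` V)"

definition cosets_of_weight :: "nat \<Rightarrow> ('a::{field,finite} ^ 'n) set \<Rightarrow> ('a ^ 'n) set set" where
  "cosets_of_weight w C = {V\<in>code_cosets C. coset_weight V = w}"

text \<open>This is both \<open>A_w(C)\<close> for a code and \<open>B_w(V)\<close> for a coset.  It is integer-valued because
  it occurs in formulas with signs and differences.\<close>

definition wt_count :: "nat \<Rightarrow> ('a::{field,finite} ^ 'n) set \<Rightarrow> int" where
  "wt_count w V = int (card {x\<in>V. hamming_weight x = w})"

text \<open>The sign \<open>(-1)^(w - d)\<close> is written with exponent \<open>w + d\<close>, which has the same parity and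
  avoids truncated subtraction.  The remaining differences are those of natural numbers; the
  definition is meant for \<open>v + 1 \<le> w \<le> n\<close> and \<open>v + 2 \<le> d\<close>.\<close>

definition Omega :: "nat \<Rightarrow> nat \<Rightarrow> nat \<Rightarrow> nat \<Rightarrow> int" where
  "Omega v w n d =
     (-1) ^ (w + d) * int ((n - v) choose (w - v)) * int ((w - 1 - v) choose (d - 2 - v))"

end

theory Submission
  imports Defs
begin

text \<open>A coset of \<open>C\<close> is the set of words with a given syndrome \<open>s = H x\<close>.  For a set \<open>T\<close> of
  coordinates with at least three elements the columns indexed by \<open>T\<close> span the whole space, so the
  number of words supported in \<open>T\<close> with syndrome \<open>s\<close> does not depend on \<open>s\<close>.  By Moebius inversion
  over supports, the weight distribution of a coset therefore differs from that of \<open>C\<close> only by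
  contributions of the sets \<open>T\<close> with at most two elements, and these record whether \<open>s\<close> is zero,
  whether it represents a point of the arc, and on how many bisecants it lies.\<close>

section \<open>Counting supersets, and the vectors in points of the plane\<close>

text \<open>Deleting \<open>T\<close> identifies these supersets with the subsets of size
  \<open>w - card T\<close> of its complement. The number says how often \<open>T\<close> occurs
  when inclusion-exclusion is summed over all supports of size \<open>w\<close>.\<close>

lemma card_superset_choose:
  fixes T :: "'n::finite set"
  assumes "card T \<le> w"
  shows "card {S. T \<subseteq> S \<and> card S = w} = (CARD('n) - card T) choose (w - card T)"
proof -
  have "bij_betw (\<lambda>S. S - T) {S. T \<subseteq> S \<and> card S = w} {B. B \<subseteq> UNIV - T \<and> card B = w - card T}"
  proof (rule bij_betw_byWitness[where f' = "\<lambda>B. B \<union> T"])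
    show "(\<lambda>B. B \<union> T) ` {B. B \<subseteq> UNIV - T \<and> card B = w - card T} \<subseteq> {S. T \<subseteq> S \<and> card S = w}"
      using assms by (auto simp: card_Un_disjoint Diff_eq inf.commute disjoint_eq_subset_Compl)
  qed (auto simp: card_Diff_subset)
  then have "card {S. T \<subseteq> S \<and> card S = w} = card {B. B \<subseteq> UNIV - T \<and> card B = w - card T}"
    by (rule bij_betw_same_card)
  also have "\<dots> = (CARD('n) - card T) choose (w - card T)"
    by (simp add: n_subsets card_Diff_subset)
  finally show ?thesis .
qed

lemma card_span_singleton_diff:
  fixes p :: "'a::{field,finite} ^ 'm"
  assumes "p \<noteq> 0"
  shows "card (vec.span {p} - {0}) = CARD('a) - 1"
proof -
  have "inj (\<lambda>c. c *s p)"
    using assms by (auto simp: inj_def)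
  then have "card (vec.span {p}) = CARD('a)"
    by (simp add: vec.span_singleton card_image)
  then show ?thesis
    by (simp add: card_Diff_subset vec.span_zero)
qed

lemma vec_span_singleton_eq:
  fixes p s :: "'a::field ^ 'm"
  assumes "s \<in> vec.span {p}" "s \<noteq> 0"
  shows "vec.span {s} = vec.span {p}"
proof -
  obtain k where k: "s = k *s p"
    using assms by (auto simp: vec.span_singleton)
  then have "k \<noteq> 0" using assms by auto
  then have "p = inverse k *s s" by (simp add: k)
  then have "p \<in> vec.span {s}"
    by (metis insertI1 vec.span_base vec.span_scale)
  then show ?thesis
    by (meson assms empty_subsetI insert_subset subset_antisym vec.span_minimal vec.subspace_span)
qed

lemma span_singleton_subset_iff:
  fixes s :: "'a::field ^ 'm"
  assumes "vec.subspace L"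
  shows "vec.span {s} \<subseteq> L \<longleftrightarrow> s \<in> L"
proof
  assume "vec.span {s} \<subseteq> L"
  moreover have "s \<in> vec.span {s}" by (simp add: vec.span_base)
  ultimately show "s \<in> L" by (rule subsetD)
next
  assume "s \<in> L"
  then show "vec.span {s} \<subseteq> L"
    using assms by (intro vec.span_minimal) auto
qed

lemma field_card_ge_2: "2 \<le> CARD('a::{field,finite})"
  using card_mono[of "UNIV :: 'a set" "{0, 1}"] by simp

lemma span_singleton_in_pg_points:
  assumes "s \<noteq> 0"
  shows "vec.span {s} \<in> pg_points"
  using assms by (simp add: pg_points_def vec.dim_eq_card_independent)

lemma pg_points_span:
  assumes "P \<in> pg_points" "s \<in> P" "s \<noteq> 0"
  shows "P = vec.span {s}"
proof -
  have "vec.span {s} = P"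
    using assms by (intro vec.subspace_dim_equal)
      (auto simp: pg_points_def vec.dim_eq_card_independent vec.span_minimal)
  then show ?thesis by simp
qed

lemma pg_points_obtain:
  assumes "P \<in> pg_points"
  obtains p where "p \<noteq> 0" "P = vec.span {p}"
proof -
  have "P \<noteq> {0}" "0 \<in> P"
    using assms by (auto simp: pg_points_def vec.subspace_0)
  then obtain p where "p \<in> P" "p \<noteq> 0" by auto
  then show thesis using that assms pg_points_span by blast
qed

text \<open>A nonzero vector lies in exactly one point, and a point has q - 1 nonzero vectors. This
  is the source of the factor q - 1 in the numbers of cosets: a coset belongs to a syndrome, while
  the geometry counts points.\<close>

lemma card_vectors_over_points:
  fixes X :: "('a::{field,finite} ^ 3) set set"
  assumes "X \<subseteq> pg_points"
  shows "card {s. s \<noteq> 0 \<and> vec.span {s} \<in> X} = (CARD('a) - 1) * card X"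
proof -
  have "{s. s \<noteq> 0 \<and> vec.span {s} \<in> X} = (\<Union>P\<in>X. P - {0})"
    using assms pg_points_span by (force intro: vec.span_base)
  also have "card \<dots> = (\<Sum>P\<in>X. card (P - {0}))"
  proof (rule card_UN_disjoint)
    show "\<forall>P\<in>X. \<forall>Q\<in>X. P \<noteq> Q \<longrightarrow> (P - {0}) \<inter> (Q - {0}) = {}"
      using assms pg_points_span by blast
  qed auto
  also have "\<dots> = (\<Sum>P\<in>X. CARD('a) - 1)"
  proof (rule sum.cong[OF refl])
    fix P assume "P \<in> X"
    then obtain p where "p \<noteq> 0" "P = vec.span {p}"
      using assms pg_points_obtain by blast
    then show "card (P - {0}) = CARD('a) - 1"
      by (simp add: card_span_singleton_diff)
  qed
  finally show ?thesis by simp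
qed

section \<open>One-point extensions and completeness of arcs\<close>

text \<open>A line through \<open>P\<close> spoils the extension exactly when it contains two points
  of \<open>A\<close>, and then it contains no third one because \<open>A\<close> is an arc; such a
  line is a bisecant.\<close>

lemma pg_arc_insert_iff:
  fixes A :: "('a::{field,finite} ^ 3) set set"
  assumes "pg_arc n A" "P \<in> pg_points - A"
  shows "pg_arc (n + 1) (insert P A) \<longleftrightarrow> {L \<in> bisecants A. P \<subseteq> L} = {}"
proof
  assume *: "pg_arc (n + 1) (insert P A)"
  show "{L \<in> bisecants A. P \<subseteq> L} = {}"
  proof (rule ccontr)
    assume "{L \<in> bisecants A. P \<subseteq> L} \<noteq> {}"
    then obtain L where L: "L \<in> pg_lines" "card {Q \<in> A. Q \<subseteq> L} = 2" "P \<subseteq> L"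
      by (auto simp: bisecants_def)
    have "card (insert P {Q \<in> A. Q \<subseteq> L}) = 3"
      using assms L by (subst card_insert_disjoint) auto
    moreover have "pg_collinear (insert P {Q \<in> A. Q \<subseteq> L})"
      using L by (auto simp: pg_collinear_def)
    moreover have "insert P {Q \<in> A. Q \<subseteq> L} \<subseteq> insert P A"
      by auto
    ultimately show False
      using * by (auto simp: pg_arc_def)
  qed
next
  assume *: "{L \<in> bisecants A. P \<subseteq> L} = {}"
  have "\<not> pg_collinear S" if S: "S \<subseteq> insert P A" "card S = 3" for S
  proof
    assume "pg_collinear S"
    then obtain L where L: "L \<in> pg_lines" "\<And>Q. Q \<in> S \<Longrightarrow> Q \<subseteq> L"
      by (auto simp: pg_collinear_def)
    show False
    proof (cases "P \<in> S")
      case False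
      then show False
        using S \<open>pg_collinear S\<close> assms(1) by (auto simp: pg_arc_def subset_insert)
    next
      case True
      \<comment> \<open>The collinear triple without \<open>P\<close> leaves at least two points of
        \<open>A\<close> on \<open>L\<close>. Exactly two would make \<open>L\<close> a bisecant
        through \<open>P\<close>, and three or more contradict that \<open>A\<close> is an
        arc.\<close>
      let ?B = "{Q \<in> A. Q \<subseteq> L}"
      have "card (S - {P}) \<le> card ?B"
        using S L by (intro card_mono) auto
      then have "2 \<le> card ?B"
        using S True by simp
      moreover have "card ?B \<noteq> 2"
        using * L True by (auto simp: bisecants_def)
      ultimately have "3 \<le> card ?B" by simp
      then obtain T where T: "T \<subseteq> ?B" "card T = 3"
        by (rule obtain_subset_with_card_n)
      then have "pg_collinear T"
        using L by (auto simp: pg_collinear_def)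
      then show False
        using T assms(1) by (auto simp: pg_arc_def)
    qed
  qed
  then show "pg_arc (n + 1) (insert P A)"
    using assms by (auto simp: pg_arc_def)
qed

lemma pg_arc_subset:
  assumes "pg_arc n A" "B \<subseteq> A"
  shows "pg_arc (card B) B"
  using assms unfolding pg_arc_def by blast

text \<open>Subsets of arcs are arcs, so a larger arc containing \<open>A\<close> yields an
  extension by a single point; such a point is one that lies on no bisecant.\<close>

lemma pg_complete_arc_iff:
  fixes A :: "('a::{field,finite} ^ 3) set set"
  assumes "pg_arc n A"
  shows "pg_complete_arc n A \<longleftrightarrow> bisecant_count A 0 = 0"
proof -
  have "pg_complete_arc n A \<longleftrightarrow> (\<forall>P\<in>pg_points - A. \<not> pg_arc (n + 1) (insert P A))"
  proof
    assume "\<forall>P\<in>pg_points - A. \<not> pg_arc (n + 1) (insert P A)"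
    moreover have "\<exists>P\<in>pg_points - A. pg_arc (n + 1) (insert P A)"
      if A': "pg_arc (n + 1) A'" "A \<subseteq> A'" for A'
    proof -
      have "A' \<noteq> A" using assms A' by (auto simp: pg_arc_def)
      then obtain P where P: "P \<in> A'" "P \<notin> A" using A' by auto
      moreover have "card (insert P A) = n + 1"
        using P assms by (simp add: pg_arc_def)
      ultimately show ?thesis
        using pg_arc_subset[OF A'(1), of "insert P A"] A' by (auto simp: pg_arc_def)
    qed
    ultimately show "pg_complete_arc n A"
      using assms by (auto simp: pg_complete_arc_def)
  qed (use assms in \<open>auto simp: pg_complete_arc_def\<close>)
  also have "\<dots> \<longleftrightarrow> bisecant_count A 0 = 0"
    using pg_arc_insert_iff[OF assms] by (auto simp: bisecant_count_def)
  finally show ?thesis .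
qed

section \<open>Supports, syndromes and binomial identities\<close>

definition support :: "'a::zero ^ 'n \<Rightarrow> 'n set" where
  "support x = {j. x $ j \<noteq> 0}"

lemma hamming_weight_support: "hamming_weight x = card (support x)"
  by (simp add: hamming_weight_def support_def)

lemma support_subset_iff: "support x \<subseteq> T \<longleftrightarrow> (\<forall>j. j \<notin> T \<longrightarrow> x $ j = 0)"
  by (auto simp: support_def)

text \<open>The syndrome of \<open>x\<close> is the combination of the columns with coefficients
  \<open>x $ j\<close>. For the converse inclusion, column \<open>j\<close> is itself the syndrome
  of the unit vector \<open>axis j 1\<close>.\<close>

lemma image_support_subset:
  fixes H :: "'a::field ^ 'n ^ 'm"
  shows "(*v) H ` {x. support x \<subseteq> T} = vec.span ((\<lambda>j. column j H) ` T)"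
proof
  show "(*v) H ` {x. support x \<subseteq> T} \<subseteq> vec.span ((\<lambda>j. column j H) ` T)"
  proof clarify
    fix x :: "'a ^ 'n" assume x: "support x \<subseteq> T"
    have "x $ j *s column j H \<in> vec.span ((\<lambda>j. column j H) ` T)" for j
      using x by (cases "j \<in> T") (simp_all add: support_subset_iff vec.span_scale vec.span_base vec.span_zero)
    then show "H *v x \<in> vec.span ((\<lambda>j. column j H) ` T)"
      unfolding matrix_mult_sum by (intro vec.span_sum)
  qed
next
  have "vec.subspace {x :: 'a ^ 'n. support x \<subseteq> T}"
    by (simp add: vec.subspace_def support_subset_iff)
  then have "vec.subspace ((*v) H ` {x. support x \<subseteq> T})"
    by (rule vec.subspace_image)
  moreover have "column j H = H *v axis j 1" for j
    by (simp add: matrix_vector_mult_def column_def axis_def vec_eq_iff if_distrib cong: if_cong)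
  then have "(\<lambda>j. column j H) ` T \<subseteq> (*v) H ` {x. support x \<subseteq> T}"
    by (auto simp: support_subset_iff axis_def intro!: imageI)
  ultimately show "vec.span ((\<lambda>j. column j H) ` T) \<subseteq> (*v) H ` {x. support x \<subseteq> T}"
    by (intro vec.span_minimal)
qed

text \<open>The right-hand side is the form in which inclusion-exclusion produces this quantity: the
  empty set, the singletons and the pairs, each weighted by its number of supersets of size
  \<open>w\<close>. It collapses since \<open>(n choose t) * ((n - t) choose (w - t)) = (n choose w)
  * (w choose t)\<close> and \<open>1 - w + (w choose 2) = ((w - 1) choose 2)\<close>.\<close>

lemma Omega_0_eq:
  assumes "2 \<le> w" "w \<le> n"
  shows "Omega 0 w n 4 = (-1) ^ w * (int (n choose w) - int n * int ((n - 1) choose (w - 1))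
    + int ((n - 2) choose (w - 2)) * int (n choose 2))"
proof -
  have "n * ((n - 1) choose (w - 1)) = w * (n choose w)"
    using assms by (simp add: times_binomial_minus1_eq)
  then have 1: "int n * int ((n - 1) choose (w - 1)) = int w * int (n choose w)"
    by (simp flip: of_nat_mult)
  have "((n - 2) choose (w - 2)) * (n choose 2) = (n choose w) * (w choose 2)"
    using assms by (simp add: choose_mult mult.commute)
  then have 2: "int ((n - 2) choose (w - 2)) * int (n choose 2) = int (n choose w) * int (w choose 2)"
    by (simp flip: of_nat_mult)
  obtain v where v: "w = Suc v"
    using assms by (cases w) auto
  have "w choose 2 = v + (v choose 2)"
    by (simp add: v numeral_2_eq_2)
  then have 3: "int (w choose 2) = int v + int (v choose 2)"
    by simp
  have "Omega 0 w n 4 = (-1) ^ w * int (n choose w) * int (v choose 2)"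
    by (simp add: Omega_def v power_add)
  also have "\<dots> = (-1) ^ w * (int (n choose w) - int w * int (n choose w)
      + int (n choose w) * int (w choose 2))"
    unfolding 3 using v by (simp add: algebra_simps)
  finally show ?thesis
    by (simp only: 1 2)
qed

text \<open>This is the correction for a syndrome representing an arc point: it lies in the span of
  one singleton and of \<open>n - 1\<close> pairs. Absorption, \<open>(n - 1) * ((n - 2) choose (w -
  2)) = (w - 1) * ((n - 1) choose (w - 1))\<close>, reduces it to a single product.\<close>

lemma Omega_1_eq:
  assumes "2 \<le> w" "w \<le> n"
  shows "Omega 1 w n 4 =
    (-1) ^ w * (int ((n - 2) choose (w - 2)) * int (n - 1) - int ((n - 1) choose (w - 1)))"
proof -
  have "(n - 1) * ((n - 2) choose (w - 2)) = (w - 1) * ((n - 1) choose (w - 1))"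
    using assms times_binomial_minus1_eq[of "w - 1" "n - 1"] by (simp add: numeral_2_eq_2)
  then have 1: "int (n - 1) * int ((n - 2) choose (w - 2)) = int (w - 1) * int ((n - 1) choose (w - 1))"
    by (simp only: flip: of_nat_mult)
  have 2: "int (w - 1) = int (w - 2) + 1"
    using assms by simp
  have "(-1 :: int) ^ (w + 4) = (-1) ^ w"
    by (simp add: power_add)
  then have "Omega 1 w n 4 = (-1) ^ w * (int (w - 2) * int ((n - 1) choose (w - 1)))"
    by (simp add: Omega_def numeral_2_eq_2)
  also have "int (w - 2) * int ((n - 1) choose (w - 1))
      = int ((n - 2) choose (w - 2)) * int (n - 1) - int ((n - 1) choose (w - 1))"
    unfolding mult.commute[of _ "int (n - 1)"] 1 2 by (simp add: distrib_right)
  finally show ?thesis .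
qed

text \<open>Allows the weight of a coset to be read off as the first nonzero entry of its weight
  distribution.\<close>

lemma coset_weight_eqI:
  assumes "wt_count w V \<noteq> 0" "\<And>v. v < w \<Longrightarrow> wt_count v V = 0"
  shows "coset_weight V = w"
  unfolding coset_weight_def
proof (rule Min_eqI)
  have "{x \<in> V. hamming_weight x = w} \<noteq> {}"
    using assms(1) unfolding wt_count_def by (metis card.empty of_nat_0)
  then show "w \<in> hamming_weight ` V" by blast
  fix v assume "v \<in> hamming_weight ` V"
  then have "{x \<in> V. hamming_weight x = v} \<noteq> {}" by blast
  then have "wt_count v V \<noteq> 0" by (simp add: wt_count_def)
  then show "w \<le> v" using assms(2) not_le by blast
qed auto

section \<open>Independence of the columns of the parity check matrix\<close>

locale arc_matrix =
  fixes H :: "'a::{field,finite} ^ 'n ^ 3" and A :: "('a ^ 3) set set"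
  assumes arc: "pg_arc (CARD('n)) A"
    and bij_points: "bij_betw (\<lambda>j. vec.span {column j H}) UNIV A"
    and CARD_ge_3: "CARD('n) \<ge> 3"
begin

abbreviation "col j \<equiv> column j H"

abbreviation "pt j \<equiv> vec.span {col j}"

lemma pt_in: "pt j \<in> A" and pt_eq_iff: "pt j = pt k \<longleftrightarrow> j = k"
  using bij_points by (auto simp: bij_betw_def inj_on_def)

lemma A_eq: "A = range pt"
  using bij_points by (auto simp: bij_betw_def)

lemma A_points: "A \<subseteq> pg_points"
  using arc by (simp add: pg_arc_def)

lemma col_nz: "col j \<noteq> 0"
proof
  assume "col j = 0"
  then have "vec.dim (pt j) = 0" by simp
  then show False using pt_in[of j] A_points by (auto simp: pg_points_def)
qed

lemma col_eq_iff: "col j = col k \<longleftrightarrow> j = k"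
  using pt_eq_iff by metis

lemma inj_col: "inj_on col T"
  by (simp add: inj_on_def col_eq_iff)

lemma independent_pair:
  assumes "j \<noteq> k"
  shows "vec.independent {col j, col k}"
proof -
  have "col j \<notin> vec.span {col k}"
    using vec_span_singleton_eq[of "col j" "col k"] col_nz pt_eq_iff assms by blast
  then show ?thesis
    using assms col_nz by (simp add: vec.independent_insert col_eq_iff)
qed

lemma pair_line:
  assumes "j \<noteq> k"
  shows "vec.span {col j, col k} \<in> pg_lines"
  using independent_pair[OF assms] assms
  by (simp add: pg_lines_def vec.dim_eq_card_independent col_eq_iff)

text \<open>Otherwise the line spanned by two of the columns would contain a third point of the
  arc.\<close>

lemma independent_triple:
  assumes "j \<noteq> k" "j \<noteq> l" "k \<noteq> l"
  shows "vec.independent {col l, col j, col k}"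
proof -
  have "col l \<notin> vec.span {col j, col k}"
  proof
    assume l: "col l \<in> vec.span {col j, col k}"
    have "pg_collinear {pt j, pt k, pt l}"
      unfolding pg_collinear_def
      using l by (intro bexI[OF _ pair_line[OF assms(1)]])
        (simp add: span_singleton_subset_iff vec.span_base)
    moreover have "card {pt j, pt k, pt l} = 3"
      using assms by (simp add: pt_eq_iff)
    ultimately show False
      using arc pt_in by (auto simp: pg_arc_def)
  qed
  then show ?thesis
    using independent_pair[OF assms(1)] assms by (simp add: vec.independent_insert col_eq_iff)
qed

text \<open>There are at least three columns, so \<open>T\<close> can be enlarged to a triple;
  independence is inherited by subsets.\<close>

lemma independent_cols:
  assumes "card T \<le> 3"
  shows "vec.independent (col ` T)"
proof -
  have "\<exists>U. T \<subseteq> U \<and> U \<subseteq> UNIV \<and> card U = 3"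
    using assms CARD_ge_3 by (intro exists_subset_between) auto
  then obtain U where U: "T \<subseteq> U" "card U = 3" by auto
  then obtain j k l where "U = {l, j, k}" "j \<noteq> k" "j \<noteq> l" "k \<noteq> l"
    by (metis card_3_iff)
  then have "vec.independent (col ` U)"
    using independent_triple by simp
  then show ?thesis
    by (rule vec.independent_mono) (rule image_mono[OF U(1)])
qed

lemma dim_span_cols:
  assumes "card T \<le> 3"
  shows "vec.dim (vec.span (col ` T)) = card T"
  using independent_cols[OF assms]
  by (simp add: vec.dim_eq_card_independent card_image inj_col)

text \<open>Three of the columns are independent and hence already a basis of the three-dimensional
  space.\<close>

lemma span_cols_eq_UNIV:
  assumes "card T \<ge> 3"
  shows "vec.span (col ` T) = UNIV"
proof -
  obtain U where U: "U \<subseteq> T" "card U = 3"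
    using assms by (rule obtain_subset_with_card_n)
  have "vec.span (col ` U) = UNIV"
    using dim_span_cols[of U] U by (intro vec.subspace_dim_equal) (auto simp: vec.dim_UNIV card_cart_basis)
  then show ?thesis
    using U(1) by (metis image_mono top.extremum_uniqueI vec.span_mono)
qed

text \<open>A nonzero codeword of weight at most 3 would be a linear dependence among at most three
  columns.\<close>

lemma syndrome_inj:
  assumes "card T \<le> 3" "support x \<subseteq> T" "H *v x = 0"
  shows "x = 0"
proof -
  have "H *v x = (\<Sum>j\<in>T. x $ j *s col j)"
    unfolding matrix_mult_sum using assms(2)
    by (intro sum.mono_neutral_right) (auto simp: support_def)
  \<comment> \<open>Independence speaks of coefficients attached to vectors, so the coefficients are
    reindexed from coordinates to columns; this is possible because distinct coordinates have
    distinct columns.\<close>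
  also have "\<dots> = (\<Sum>v\<in>col ` T. x $ (inv_into T col v) *s v)"
    by (auto simp: sum.reindex[OF inj_col] inv_into_f_f[OF inj_col] intro!: sum.cong)
  finally have "(\<Sum>v\<in>col ` T. x $ (inv_into T col v) *s v) = 0"
    using assms by simp
  then have "x $ j = 0" if "j \<in> T" for j
    using vec.independentD[OF independent_cols[OF assms(1)], of "col ` T" "\<lambda>v. x $ (inv_into T col v)" "col j"]
      that by (simp add: inv_into_f_f[OF inj_col])
  then show ?thesis
    using assms(2) by (auto simp: support_def vec_eq_iff)
qed

section \<open>Weight distribution of a syndrome fibre by Moebius inversion\<close>

definition fiber where "fiber s = {x. H *v x = s}"

text \<open>The sets \<open>T\<close> need not be minimal: a pair counts even if one of its columns
  alone already represents \<open>s\<close>.\<close>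

definition cover where "cover t s = card {T. card T = t \<and> s \<in> vec.span (col ` T)}"

lemma surj_syndrome: "\<exists>x. H *v x = s"
proof -
  have "s \<in> (*v) H ` {x. support x \<subseteq> UNIV}"
    using span_cols_eq_UNIV[of UNIV] CARD_ge_3 by (simp only: image_support_subset) simp
  then show ?thesis by auto
qed

text \<open>The columns in \<open>T\<close> span everything, so some word \<open>y\<close> supported
  in \<open>T\<close> has syndrome \<open>s\<close>; translation by \<open>y\<close> matches the two
  sets.\<close>

lemma supported_fiber_card_eq:
  assumes "card T \<ge> 3"
  shows "card {x \<in> fiber s. support x \<subseteq> T} = card {x \<in> fiber 0. support x \<subseteq> T}"
proof -
  have "s \<in> (*v) H ` {x. support x \<subseteq> T}"
    using span_cols_eq_UNIV[OF assms] by (simp add: image_support_subset)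
  then obtain y where y: "H *v y = s" "support y \<subseteq> T" by auto
  have "bij_betw (\<lambda>x. x - y) {x \<in> fiber s. support x \<subseteq> T} {x \<in> fiber 0. support x \<subseteq> T}"
    by (rule bij_betw_byWitness[where f' = "\<lambda>x. x + y"])
      (use y in \<open>auto simp: fiber_def support_subset_iff vec.diff vec.add\<close>)
  then show ?thesis by (rule bij_betw_same_card)
qed

text \<open>Membership in the span gives a word with syndrome \<open>s\<close>, and independence of
  at most three columns makes it unique.\<close>

lemma supported_fiber_card_small:
  assumes "card T \<le> 3"
  shows "card {x \<in> fiber s. support x \<subseteq> T} = of_bool (s \<in> vec.span (col ` T))"
proof (cases "s \<in> vec.span (col ` T)")
  case True
  then have "s \<in> (*v) H ` {x. support x \<subseteq> T}"
    by (simp only: image_support_subset)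
  then obtain y where y: "H *v y = s" "support y \<subseteq> T"
    by blast
  have "x = y" if "H *v x = s" "support x \<subseteq> T" for x
  proof -
    have "x - y = 0"
    proof (rule syndrome_inj[OF assms])
      show "support (x - y) \<subseteq> T"
        using that y by (simp add: support_subset_iff)
      show "H *v (x - y) = 0"
        using that y by (simp add: vec.diff)
    qed
    then show ?thesis by simp
  qed
  then have "{x \<in> fiber s. support x \<subseteq> T} = {y}"
    unfolding fiber_def using y by blast
  then show ?thesis using True by simp
next
  case False
  then have "s \<notin> (*v) H ` {x. support x \<subseteq> T}"
    by (simp only: image_support_subset) simp
  then have "{x \<in> fiber s. support x \<subseteq> T} = {}"
    unfolding fiber_def by blast
  then show ?thesis using False by simp
qed

text \<open>For each support, subtract the inclusion-exclusion formula for the code from that for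
  the fibre. Sets \<open>T\<close> with at least three elements cancel; a smaller \<open>T\<close>
  contributes 1 or 0 for the fibre and always 1 for the code, which supports only the zero word
  there. Summation over the sets \<open>T\<close> of size \<open>t\<close> gives
  \<open>cover t s\<close> minus the number of all such sets.\<close>

lemma wt_count_fiber:
  "wt_count w (fiber s) = wt_count w (fiber 0) +
     (\<Sum>t\<in>{t. t \<le> 2 \<and> t \<le> w}. (-1) ^ (w + t) * int ((CARD('n) - t) choose (w - t))
        * (int (cover t s) - int (CARD('n) choose t)))"
proof -
  let ?F = "\<lambda>T s. int (card {x \<in> fiber s. support x \<subseteq> T})"
  let ?N = "\<lambda>S s. int (card {x \<in> fiber s. support x = S})"
  have wt: "wt_count w (fiber s) = (\<Sum>S | card S = w. ?N S s)" for s
  proof -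
    have "{x \<in> fiber s. hamming_weight x = w} = (\<Union>S\<in>{S. card S = w}. {x \<in> fiber s. support x = S})"
      by (auto simp: hamming_weight_support)
    then have "card {x \<in> fiber s. hamming_weight x = w} = (\<Sum>S | card S = w. card {x \<in> fiber s. support x = S})"
      by (simp only:) (rule card_UN_disjoint; auto)
    then show ?thesis by (simp add: wt_count_def)
  qed
  have "?F T s = (\<Sum>S\<in>Pow T. ?N S s)" for T s
  proof -
    have "{x \<in> fiber s. support x \<subseteq> T} = (\<Union>S\<in>Pow T. {x \<in> fiber s. support x = S})"
      by auto
    then have "card {x \<in> fiber s. support x \<subseteq> T} = (\<Sum>S\<in>Pow T. card {x \<in> fiber s. support x = S})"
      by (simp only:) (rule card_UN_disjoint; auto)
    then show ?thesis by simp
  qed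
  then have moebius: "?N S s = (\<Sum>T\<in>Pow S. (-1) ^ (card S - card T) * ?F T s)" for S s
    by (rule inclusion_exclusion_mobius) auto
  let ?D = "\<lambda>T. ?F T s - ?F T 0"
  have diff: "?N S s - ?N S 0 = (\<Sum>T\<in>Pow S. (-1) ^ (card S + card T) * ?D T)" for S
    unfolding moebius sum_subtractf[symmetric]
    by (intro sum.cong refl)
      (simp add: card_mono neg_one_power_add_eq_neg_one_power_diff right_diff_distrib)
  have D_large: "?D T = 0" if "card T \<ge> 3" for T
    using supported_fiber_card_eq[OF that, of s] by simp
  have D_small: "?D T = of_bool (s \<in> vec.span (col ` T)) - 1" if "card T \<le> 2" for T
    using that by (simp add: supported_fiber_card_small vec.span_zero)
  have "wt_count w (fiber s) - wt_count w (fiber 0)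
      = (\<Sum>S | card S = w. \<Sum>T | T \<subseteq> S. (-1) ^ (w + card T) * ?D T)"
    unfolding wt sum_subtractf[symmetric] diff
    by (intro sum.cong) auto
  \<comment> \<open>After the exchange of the sums the summand no longer depends on
    \<open>S\<close>, so the inner sum only counts the supersets of \<open>T\<close> of size
    \<open>w\<close>.\<close>
  also have "\<dots> = (\<Sum>T\<in>UNIV. \<Sum>S | S \<in> {S. card S = w} \<and> T \<subseteq> S. (-1) ^ (w + card T) * ?D T)"
    using sum.swap_restrict[of "{S. card S = w}" UNIV "\<lambda>S T. (-1) ^ (w + card T) * ?D T" "\<lambda>S T. T \<subseteq> S"]
    by simp
  also have "\<dots> = (\<Sum>T\<in>UNIV. int (card {S. T \<subseteq> S \<and> card S = w}) * ((-1) ^ (w + card T) * ?D T))"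
    by (simp add: conj_commute)
  also have "\<dots> = (\<Sum>T | card T \<in> {t. t \<le> 2 \<and> t \<le> w}.
      int (card {S. T \<subseteq> S \<and> card S = w}) * ((-1) ^ (w + card T) * ?D T))"
  \<comment> \<open>A set larger than \<open>w\<close> has no superset of size \<open>w\<close>.
    Discarding it here also keeps the truncated difference \<open>w - card T\<close> exact in what
    follows.\<close>
  proof (rule sum.mono_neutral_right)
    have "int (card {S. T \<subseteq> S \<and> card S = w}) * ((-1) ^ (w + card T) * ?D T) = 0"
      if "\<not> (card T \<le> 2 \<and> card T \<le> w)" for T
    proof (cases "card T \<le> 2")
      case True
      then have "w < card T" using that by simp
      have False if "T \<subseteq> S" "card S = w" for S
        using card_mono[OF finite that(1)] that(2) \<open>w < card T\<close> by linarith
      then have "{S. T \<subseteq> S \<and> card S = w} = {}" by blast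
      then show ?thesis by (simp only: card.empty of_nat_0 mult_zero_left)
    next
      case False
      then have "?D T = 0" by (intro D_large) simp
      then show ?thesis by (simp only: mult_zero_right)
    qed
    then show "\<forall>T\<in>UNIV - {T. card T \<in> {t. t \<le> 2 \<and> t \<le> w}}.
        int (card {S. T \<subseteq> S \<and> card S = w}) * ((-1) ^ (w + card T) * ?D T) = 0"
      by blast
  qed auto
  also have "\<dots> = (\<Sum>T | card T \<in> {t. t \<le> 2 \<and> t \<le> w}.
      int ((CARD('n) - card T) choose (w - card T)) * (-1) ^ (w + card T)
        * (of_bool (s \<in> vec.span (col ` T)) - 1))"
    by (intro sum.cong refl) (simp add: card_superset_choose D_small del: of_nat_diff)
  also have "\<dots> = (\<Sum>t\<in>{t. t \<le> 2 \<and> t \<le> w}. \<Sum>T\<in>{T \<in> {T. card T \<in> {t. t \<le> 2 \<and> t \<le> w}}. card T = t}.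
      int ((CARD('n) - card T) choose (w - card T)) * (-1) ^ (w + card T)
        * (of_bool (s \<in> vec.span (col ` T)) - 1))"
    by (rule sum.group[symmetric]) auto
  also have "\<dots> = (\<Sum>t\<in>{t. t \<le> 2 \<and> t \<le> w}. (-1) ^ (w + t) * int ((CARD('n) - t) choose (w - t))
        * (int (cover t s) - int (CARD('n) choose t)))"
  proof (rule sum.cong[OF refl])
    fix t assume t: "t \<in> {t. t \<le> 2 \<and> t \<le> w}"
    have "{T :: 'n set. card T \<in> {t. t \<le> 2 \<and> t \<le> w} \<and> card T = t} = {T. card T = t}"
      using t by auto
    moreover have "(\<Sum>T | card T = t. of_bool (s \<in> vec.span (col ` T)) - 1 :: int)
        = int (cover t s) - int (CARD('n) choose t)"
      using n_subsets[of "UNIV :: 'n set" t]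
      by (simp add: sum_subtractf cover_def Int_def)
    ultimately show "(\<Sum>T\<in>{T \<in> {T. card T \<in> {t. t \<le> 2 \<and> t \<le> w}}. card T = t}.
      int ((CARD('n) - card T) choose (w - card T)) * (-1) ^ (w + card T)
        * (of_bool (s \<in> vec.span (col ` T)) - 1))
      = (-1) ^ (w + t) * int ((CARD('n) - t) choose (w - t))
        * (int (cover t s) - int (CARD('n) choose t))"
      by (simp add: sum_distrib_left[symmetric] mult_ac)
  qed
  finally show ?thesis by simp
qed

section \<open>Geometric meaning of the covering numbers\<close>

text \<open>A further column in the span would give at most three dependent columns.\<close>

lemma col_in_span_iff:
  assumes "card T \<le> 2"
  shows "col j \<in> vec.span (col ` T) \<longleftrightarrow> j \<in> T"
proof
  assume j: "col j \<in> vec.span (col ` T)"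
  show "j \<in> T"
  proof (rule ccontr)
    assume "j \<notin> T"
    then have "card (insert j T) \<le> 3" using assms by simp
    then have "vec.independent (col ` insert j T)" by (rule independent_cols)
    moreover have "col j \<notin> col ` T" using \<open>j \<notin> T\<close> by (auto simp: col_eq_iff)
    ultimately show False using j by (simp add: vec.independent_insert)
  qed
qed (simp add: vec.span_base)

lemma points_on_subspace:
  assumes "vec.subspace L"
  shows "{P \<in> A. P \<subseteq> L} = pt ` {j. col j \<in> L}"
  unfolding A_eq span_singleton_subset_iff[OF assms, symmetric] by blast

lemma card_pt_image: "card (pt ` T) = card T"
  by (rule card_image) (simp add: inj_on_def pt_eq_iff)

lemma span_pair_bisecant:
  assumes "card T = 2"
  shows "vec.span (col ` T) \<in> bisecants A"
proof -
  have "vec.span (col ` T) \<in> pg_lines"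
    using dim_span_cols[of T] assms by (simp add: pg_lines_def del: vec.dim_span)
  moreover have "{P \<in> A. P \<subseteq> vec.span (col ` T)} = pt ` T"
    using assms by (simp add: points_on_subspace col_in_span_iff)
  ultimately show ?thesis
    using assms by (simp add: bisecants_def card_pt_image)
qed

text \<open>The two arc points on a bisecant have independent columns, whose span lies in the line
  and has the same dimension.\<close>

lemma bisecant_eq_span:
  assumes "L \<in> bisecants A"
  shows "card {j. col j \<in> L} = 2" "L = vec.span (col ` {j. col j \<in> L})"
proof -
  have L: "vec.subspace L" "vec.dim L = 2" "card {P \<in> A. P \<subseteq> L} = 2"
    using assms by (auto simp: bisecants_def pg_lines_def)
  then show card: "card {j. col j \<in> L} = 2"
    by (simp add: points_on_subspace card_pt_image)
  have "vec.span (col ` {j. col j \<in> L}) = L"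
  proof (rule vec.subspace_dim_equal)
    show "vec.span (col ` {j. col j \<in> L}) \<subseteq> L"
      using L(1) by (intro vec.span_minimal) auto
    show "vec.dim L \<le> vec.dim (vec.span (col ` {j. col j \<in> L}))"
      using dim_span_cols[of "{j. col j \<in> L}"] card L(2) by simp
  qed (use L in auto)
  then show "L = vec.span (col ` {j. col j \<in> L})" ..
qed

lemma cover_0: "cover 0 s = of_bool (s = 0)"
proof -
  have "{T :: 'n set. card T = 0 \<and> s \<in> vec.span (col ` T)} = (if s = 0 then {{}} else {})"
    by auto
  then show ?thesis by (simp add: cover_def)
qed

lemma in_pt_iff:
  assumes "s \<noteq> 0"
  shows "s \<in> pt j \<longleftrightarrow> vec.span {s} = pt j"
  using assms vec_span_singleton_eq[of s "col j"] span_singleton_subset_iff[of "pt j" s]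
  by auto

lemma cover_1:
  assumes "s \<noteq> 0"
  shows "cover 1 s = of_bool (vec.span {s} \<in> A)"
proof (cases "vec.span {s} \<in> A")
  case True
  then obtain j where j: "vec.span {s} = pt j" by (auto simp: A_eq)
  have "{T. card T = 1 \<and> s \<in> vec.span (col ` T)} = {{j}}"
    using assms j by (auto simp: card_1_singleton_iff in_pt_iff pt_eq_iff)
  then show ?thesis using True by (simp add: cover_def)
next
  case False
  then have "{T. card T = 1 \<and> s \<in> vec.span (col ` T)} = {}"
    using assms by (auto simp: card_1_singleton_iff in_pt_iff A_eq)
  then show ?thesis using False by (simp add: cover_def)
qed

text \<open>Pairs of coordinates and bisecants correspond: a pair spans a bisecant, and a bisecant
  returns the two columns that it contains. A pair covers \<open>s\<close> exactly when its bisecant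
  passes through the subspace generated by \<open>s\<close>.\<close>

lemma cover_2: "cover 2 s = card {L \<in> bisecants A. vec.span {s} \<subseteq> L}"
proof -
  have "bij_betw (\<lambda>T. vec.span (col ` T)) {T. card T = 2 \<and> s \<in> vec.span (col ` T)}
      {L \<in> bisecants A. vec.span {s} \<subseteq> L}"
  proof (rule bij_betw_byWitness[where f' = "\<lambda>L. {j. col j \<in> L}"])
    show "\<forall>T\<in>{T. card T = 2 \<and> s \<in> vec.span (col ` T)}. {j. col j \<in> vec.span (col ` T)} = T"
      by (simp add: col_in_span_iff)
    show "\<forall>L\<in>{L \<in> bisecants A. vec.span {s} \<subseteq> L}. vec.span (col ` {j. col j \<in> L}) = L"
      using bisecant_eq_span(2) by simp
    show "(\<lambda>T. vec.span (col ` T)) ` {T. card T = 2 \<and> s \<in> vec.span (col ` T)}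
        \<subseteq> {L \<in> bisecants A. vec.span {s} \<subseteq> L}"
      by (simp add: image_subset_iff span_pair_bisecant span_singleton_subset_iff)
    show "(\<lambda>L. {j. col j \<in> L}) ` {L \<in> bisecants A. vec.span {s} \<subseteq> L}
        \<subseteq> {T. card T = 2 \<and> s \<in> vec.span (col ` T)}"
    proof (rule image_subsetI, rule CollectI, rule conjI)
      fix L assume L: "L \<in> {L \<in> bisecants A. vec.span {s} \<subseteq> L}"
      then show "card {j. col j \<in> L} = 2" by (simp add: bisecant_eq_span(1))
      have "vec.subspace L" using L by (auto simp: bisecants_def pg_lines_def)
      then have "s \<in> L" using L by (simp add: span_singleton_subset_iff)
      then show "s \<in> vec.span (col ` {j. col j \<in> L})"
        using bisecant_eq_span(2)[of L] L by simp
    qed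
  qed
  then show ?thesis
    unfolding cover_def by (rule bij_betw_same_card)
qed

text \<open>Here \<open>s\<close> is a multiple of a column \<open>col j\<close>, and a pair spans a
  subspace containing that column exactly when \<open>j\<close> belongs to the pair.\<close>

lemma cover_2_point:
  assumes "s \<noteq> 0" "vec.span {s} \<in> A"
  shows "cover 2 s = CARD('n) - 1"
proof -
  obtain j where j: "vec.span {s} = pt j" using assms(2) by (auto simp: A_eq)
  have iff: "s \<in> vec.span (col ` T) \<longleftrightarrow> j \<in> T" if "card T = 2" for T
    using j span_singleton_subset_iff[of "vec.span (col ` T)" s]
      span_singleton_subset_iff[of "vec.span (col ` T)" "col j"] col_in_span_iff[of T j] that
    by simp
  have "{T. card T = 2 \<and> s \<in> vec.span (col ` T)} = {T. {j} \<subseteq> T \<and> card T = 2}"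
    using iff by auto
  then show ?thesis
    using card_superset_choose[of "{j}" 2] by (simp add: cover_def)
qed

section \<open>Low weights and the weight of a coset\<close>

lemma wt_count_fiber_0:
  assumes "w \<le> 3"
  shows "wt_count w (fiber 0) = of_bool (w = 0)"
proof -
  have "x = 0" if "x \<in> fiber 0" "hamming_weight x = w" for x
    using syndrome_inj[of "support x" x] that assms by (simp add: fiber_def hamming_weight_support)
  moreover have "0 \<in> fiber 0" "hamming_weight (0 :: 'a ^ 'n) = 0"
    by (simp_all add: fiber_def hamming_weight_def)
  ultimately have "{x \<in> fiber 0. hamming_weight x = w} = (if w = 0 then {0} else {})"
    by (cases "w = 0") fastforce+
  then show ?thesis by (simp add: wt_count_def)
qed

text \<open>All of 0, 1 and 2 occur as \<open>t\<close>, and \<open>cover 0 s\<close> vanishes for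
  nonzero \<open>s\<close>. The parts without covering numbers add up to
  \<open>- Omega 0\<close>.\<close>

lemma wt_count_fiber_Omega:
  assumes "s \<noteq> 0" "2 \<le> w" "w \<le> CARD('n)"
  shows "wt_count w (fiber s) = wt_count w (fiber 0) - Omega 0 w (CARD('n)) 4
    + (-1) ^ w * (int ((CARD('n) - 2) choose (w - 2)) * int (cover 2 s)
        - int ((CARD('n) - 1) choose (w - 1)) * int (cover 1 s))"
proof -
  have "{t. t \<le> 2 \<and> t \<le> w} = {0, 1, 2}"
    using assms(2) by auto
  then show ?thesis
    using assms unfolding wt_count_fiber[of w s] Omega_0_eq[OF assms(2,3)]
    by (simp add: cover_0 power_add algebra_simps)
qed

lemma wt_count_fiber_small:
  assumes "s \<noteq> 0"
  shows "wt_count 0 (fiber s) = 0" "wt_count 1 (fiber s) = int (cover 1 s)"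
    "wt_count 2 (fiber s) = int (cover 2 s) - int (CARD('n) - 1) * int (cover 1 s)"
    "wt_count 3 (fiber s) = int (CARD('n) choose 3) - int (CARD('n) - 2) * int (cover 2 s)
      + int ((CARD('n) - 1) choose 2) * int (cover 1 s)"
proof -
  have "{t::nat. t \<le> 2 \<and> t \<le> 0} = {0}" by auto
  then show "wt_count 0 (fiber s) = 0"
    using assms by (simp add: wt_count_fiber[of 0 s] wt_count_fiber_0 cover_0)
  have "{t::nat. t \<le> 2 \<and> t \<le> 1} = {0, 1}" by auto
  then show "wt_count 1 (fiber s) = int (cover 1 s)"
    using assms unfolding wt_count_fiber[of 1 s] by (simp add: wt_count_fiber_0 cover_0)
  \<comment> \<open>The \<open>Omega\<close> term is zero at weight 2 because
    \<open>1 choose 2 = 0\<close>.\<close>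
  show "wt_count 2 (fiber s) = int (cover 2 s) - int (CARD('n) - 1) * int (cover 1 s)"
    using wt_count_fiber_Omega[OF assms, of 2] CARD_ge_3
    by (simp add: wt_count_fiber_0 Omega_def)
  \<comment> \<open>At weight 3 the code contributes nothing and \<open>Omega 0\<close> equals minus
    \<open>CARD('n) choose 3\<close>.\<close>
  show "wt_count 3 (fiber s) = int (CARD('n) choose 3) - int (CARD('n) - 2) * int (cover 2 s)
      + int ((CARD('n) - 1) choose 2) * int (cover 1 s)"
    using wt_count_fiber_Omega[OF assms, of 3] CARD_ge_3
    by (simp add: wt_count_fiber_0 Omega_def)
qed

lemma coset_weight_fiber:
  "coset_weight (fiber s) =
    (if s = 0 then 0 else if vec.span {s} \<in> A then 1 else if cover 2 s \<noteq> 0 then 2 else 3)"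
proof (cases "s = 0")
  case True
  then show ?thesis by (auto intro!: coset_weight_eqI simp: wt_count_fiber_0)
next
  case s: False
  consider "vec.span {s} \<in> A" | "vec.span {s} \<notin> A" "cover 2 s \<noteq> 0"
    | "vec.span {s} \<notin> A" "cover 2 s = 0" by blast
  then show ?thesis
  proof cases
    case 1
    then have "coset_weight (fiber s) = 1"
      using wt_count_fiber_small[OF s] cover_1[OF s] by (intro coset_weight_eqI) auto
    then show ?thesis using 1 s by simp
  next
    case 2
    then have "coset_weight (fiber s) = 2"
      using wt_count_fiber_small[OF s] cover_1[OF s]
      by (intro coset_weight_eqI) (auto simp: less_2_cases_iff)
    then show ?thesis using 2 s by simp
  next
    case 3
    \<comment> \<open>Both covering numbers vanish, so the counts up to weight 2 are zero and the
      count at weight 3 is \<open>CARD('n) choose 3\<close>, which is positive because there are at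
      least three coordinates.\<close>
    have "v = 0 \<or> v = 1 \<or> v = 2" if "v < 3" for v :: nat
      using that by linarith
    then have "coset_weight (fiber s) = 3"
      using wt_count_fiber_small[OF s] cover_1[OF s] CARD_ge_3 3
      by (intro coset_weight_eqI) auto
    then show ?thesis using 3 s by simp
  qed
qed

section \<open>Cosets as fibres, and their number\<close>

lemma inj_fiber: "inj fiber"
proof (rule injI)
  fix s t assume "fiber s = fiber t"
  moreover obtain x where "H *v x = s" using surj_syndrome by blast
  ultimately show "s = t" unfolding fiber_def by blast
qed

text \<open>The translate of the code by \<open>v\<close> is the fibre over the syndrome of
  \<open>v\<close>, and every vector is a syndrome. With \<open>inj_fiber\<close>, counting cosets
  becomes counting syndromes.\<close>

lemma code_cosets_fiber: "code_cosets (fiber 0) = range fiber"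
proof -
  have "(\<lambda>c. c + v) ` fiber 0 = fiber (H *v v)" for v
  proof -
    have "x \<in> (\<lambda>c. c + v) ` fiber 0" if "x \<in> fiber (H *v v)" for x
      using that by (intro image_eqI[of _ _ "x - v"]) (simp_all add: fiber_def vec.diff)
    then show ?thesis
      by (auto simp: fiber_def vec.add)
  qed
  then have "code_cosets (fiber 0) = fiber ` range ((*v) H)"
    unfolding code_cosets_def image_image by simp
  moreover have "range ((*v) H) = UNIV"
    using surj_syndrome unfolding surj_def by metis
  ultimately show ?thesis by simp
qed

lemma cosets_of_weight_fiber: "cosets_of_weight w (fiber 0) = fiber ` {s. coset_weight (fiber s) = w}"
  by (auto simp: cosets_of_weight_def code_cosets_fiber)

lemma card_fiber_image: "card (fiber ` X) = card X"
  by (rule card_image) (rule inj_on_subset[OF inj_fiber subset_UNIV])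

lemma card_syndromes_on_arc: "card {s. s \<noteq> 0 \<and> vec.span {s} \<in> A} = (CARD('a) - 1) * CARD('n)"
  using card_vectors_over_points[OF A_points] arc by (simp add: pg_arc_def)

lemma card_syndromes_off_arc:
  "card {s. s \<noteq> 0 \<and> vec.span {s} \<notin> A \<and> cover 2 s = k} = (CARD('a) - 1) * bisecant_count A k"
proof -
  have "{s. s \<noteq> 0 \<and> vec.span {s} \<notin> A \<and> cover 2 s = k}
      = {s. s \<noteq> 0 \<and> vec.span {s} \<in> {P \<in> pg_points - A. card {L \<in> bisecants A. P \<subseteq> L} = k}}"
    using span_singleton_in_pg_points by (auto simp: cover_2)
  then show ?thesis
    using card_vectors_over_points[of "{P \<in> pg_points - A. card {L \<in> bisecants A. P \<subseteq> L} = k}"]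
    by (simp add: bisecant_count_def)
qed

lemma bisecant_count_nz_iff:
  "bisecant_count A k \<noteq> 0 \<longleftrightarrow> (\<exists>s. s \<noteq> 0 \<and> vec.span {s} \<notin> A \<and> cover 2 s = k)"
proof -
  have "bisecant_count A k \<noteq> 0 \<longleftrightarrow> card {s. s \<noteq> 0 \<and> vec.span {s} \<notin> A \<and> cover 2 s = k} \<noteq> 0"
    using field_card_ge_2[where 'a = 'a] by (simp add: card_syndromes_off_arc)
  also have "\<dots> \<longleftrightarrow> (\<exists>s. s \<noteq> 0 \<and> vec.span {s} \<notin> A \<and> cover 2 s = k)"
    by simp
  finally show ?thesis .
qed

section \<open>Covering radius as the largest coset weight\<close>

text \<open>The differences \<open>v - c\<close> run exactly through the coset of \<open>v\<close>,
  so the distance from \<open>v\<close> to the code is the weight of this coset.\<close>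

lemma hamming_dist_le_iff:
  "(\<exists>c\<in>fiber 0. hamming_dist v c \<le> R) \<longleftrightarrow> coset_weight (fiber (H *v v)) \<le> R"
proof -
  have "hamming_dist v c = hamming_weight (v - c)" for c :: "'a ^ 'n"
    by (simp add: hamming_dist_def hamming_weight_def)
  moreover have "fiber (H *v v) = (\<lambda>c. v - c) ` fiber 0"
  proof -
    have "x \<in> (\<lambda>c. v - c) ` fiber 0" if "x \<in> fiber (H *v v)" for x
      using that by (intro image_eqI[of _ _ "v - x"]) (simp_all add: fiber_def vec.diff)
    then show ?thesis
      by (auto simp: fiber_def vec.diff)
  qed
  \<comment> \<open>This makes the coset nonempty, as required for comparing its minimum with
    \<open>R\<close>.\<close>
  moreover have "0 \<in> fiber 0" by (simp add: fiber_def)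
  ultimately show ?thesis
    by (subst coset_weight_def, subst Min_le_iff) auto
qed

lemma covering_radius_fiber:
  "covering_radius (fiber 0) = (LEAST R. \<forall>s. coset_weight (fiber s) \<le> R)"
proof -
  have "(\<forall>v. \<exists>c\<in>fiber 0. hamming_dist v c \<le> R) \<longleftrightarrow> (\<forall>s. coset_weight (fiber s) \<le> R)" for R
    unfolding hamming_dist_le_iff using surj_syndrome by metis
  then show ?thesis by (simp add: covering_radius_def)
qed

lemma covering_radius_eqI:
  assumes "\<And>s. coset_weight (fiber s) \<le> R" "coset_weight (fiber s) = R"
  shows "covering_radius (fiber 0) = R"
  unfolding covering_radius_fiber
proof (rule Least_equality)
  fix r assume "\<forall>s. coset_weight (fiber s) \<le> r"
  then show "R \<le> r" using assms(2) by metis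
qed (use assms(1) in blast)

section \<open>The cosets of weights 1, 2 and 3\<close>

lemma weight_1_cosets:
  "card (cosets_of_weight 1 (fiber 0)) = CARD('n) * (CARD('a) - 1) \<and>
    (\<forall>V\<in>cosets_of_weight 1 (fiber 0).
       wt_count 0 V = 0 \<and> wt_count 2 V = 0 \<and> wt_count 1 V = 1 \<and>
       wt_count 3 V = int ((CARD('n) - 1) choose 3) \<and>
       (\<forall>w\<in>{4..CARD('n)}. wt_count w V
          = wt_count w (fiber 0) - Omega 0 w (CARD('n)) 4 + Omega 1 w (CARD('n)) 4))"
proof (intro conjI ballI)
  have eq: "cosets_of_weight 1 (fiber 0) = fiber ` {s. s \<noteq> 0 \<and> vec.span {s} \<in> A}"
    unfolding cosets_of_weight_fiber
    by (rule arg_cong[of _ _ "image fiber"]) (auto simp: coset_weight_fiber split: if_splits)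
  then show "card (cosets_of_weight 1 (fiber 0)) = CARD('n) * (CARD('a) - 1)"
    by (simp add: card_fiber_image card_syndromes_on_arc)
  fix V assume "V \<in> cosets_of_weight 1 (fiber 0)"
  then obtain s where s: "V = fiber s" "s \<noteq> 0" "vec.span {s} \<in> A"
    unfolding eq by blast
  have c: "cover 1 s = 1" "cover 2 s = CARD('n) - 1"
    using s cover_1 cover_2_point by auto
  show "wt_count 0 V = 0" "wt_count 2 V = 0" "wt_count 1 V = 1"
    using wt_count_fiber_small[OF s(2)] c s(1) by simp_all
  \<comment> \<open>With n coordinates, the count at weight 3 is
    \<open>(n choose 3) - (n - 2) * (n - 1) + ((n - 1) choose 2)\<close>. Since
    \<open>(n - 1) * (n - 2)\<close> is twice \<open>(n - 1) choose 2\<close>, Pascal's rule leaves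
    \<open>(n - 1) choose 3\<close>. Writing n as m + 3 removes truncated subtraction.\<close>
  obtain m where m: "CARD('n) = Suc (Suc (Suc m))"
    using CARD_ge_3 by (metis le_Suc_ex add_Suc numeral_3_eq_3 plus_nat.add_0)
  have "2 * (Suc (Suc m) choose 2) = Suc (Suc m) * Suc m"
    using choose_two[of "Suc (Suc m)"] by simp
  then have "2 * int (Suc (Suc m) choose 2) = (int m + 2) * (int m + 1)"
    by (metis (mono_tags) of_nat_mult of_nat_numeral of_nat_Suc add.commute add.left_commute one_add_one)
  then have "int (Suc (Suc m) choose 2) + int (Suc (Suc m) choose 2) = (int m + 1) * (int m + 2)"
    by (simp add: mult.commute)
  moreover have "Suc (Suc (Suc m)) choose 3 = (Suc (Suc m) choose 3) + (Suc (Suc m) choose 2)"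
    by (simp only: numeral_3_eq_3 numeral_2_eq_2 binomial_Suc_Suc)
  ultimately show "wt_count 3 V = int ((CARD('n) - 1) choose 3)"
    using wt_count_fiber_small(4)[OF s(2)] unfolding c s(1) m
    by (simp add: algebra_simps)
  fix w assume "w \<in> {4..CARD('n)}"
  then have w: "2 \<le> w" "w \<le> CARD('n)" by auto
  show "wt_count w V
      = wt_count w (fiber 0) - Omega 0 w (CARD('n)) 4 + Omega 1 w (CARD('n)) 4"
    unfolding s(1) wt_count_fiber_Omega[OF s(2) w] Omega_1_eq[OF w] c by simp
qed

lemma wt_count_weight_2:
  assumes "s \<noteq> 0" "vec.span {s} \<notin> A" "2 \<le> w" "w \<le> CARD('n)"
  shows "wt_count w (fiber s) = wt_count w (fiber 0) - Omega 0 w (CARD('n)) 4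
    + (-1) ^ w * int ((CARD('n) - 2) choose (CARD('n) - w)) * int (cover 2 s)"
proof -
  have "(CARD('n) - 2) choose (w - 2) = (CARD('n) - 2) choose (CARD('n) - w)"
  proof -
    have "w - 2 \<le> CARD('n) - 2" "CARD('n) - 2 - (w - 2) = CARD('n) - w"
      using assms(3,4) by simp_all
    then show ?thesis
      using binomial_symmetric[of "w - 2" "CARD('n) - 2"] by (simp only:)
  qed
  then show ?thesis
    using wt_count_fiber_Omega[OF assms(1,3,4)] cover_1[OF assms(1)] assms(2) by simp
qed

text \<open>Replacing \<open>w\<close> by \<open>CARD('n) + 2 - w\<close> reflects the binomial
  coefficient onto itself and multiplies the sign by \<open>(-1) ^ CARD('n)\<close>. The terms with
  \<open>cover 2 s\<close> therefore cancel, and the right-hand side is the same for all such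
  \<open>s\<close>.\<close>

lemma wt_count_symmetric_difference:
  assumes "s \<noteq> 0" "vec.span {s} \<notin> A" "3 \<le> w" "w \<le> CARD('n)"
  shows "(-1) ^ CARD('n) * wt_count w (fiber s) - wt_count (CARD('n) + 2 - w) (fiber s) =
    (-1) ^ CARD('n) * (wt_count w (fiber 0) - Omega 0 w (CARD('n)) 4)
      - (wt_count (CARD('n) + 2 - w) (fiber 0) - Omega 0 (CARD('n) + 2 - w) (CARD('n)) 4)"
proof -
  let ?n = "CARD('n)" and ?v = "CARD('n) + 2 - w"
  have v: "2 \<le> ?v" "?v \<le> ?n" using assms by auto
  have "?n - ?v = w - 2" "w - 2 \<le> ?n - 2" "?n - 2 - (w - 2) = ?n - w"
    using assms by simp_all
  then have choose: "(?n - 2) choose (?n - ?v) = (?n - 2) choose (?n - w)"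
    using binomial_symmetric[of "w - 2" "?n - 2"] by (simp only:)
  have "?v + w = ?n + 2" using assms by simp
  then have "(-1 :: int) ^ ?v * (-1) ^ w = (-1) ^ ?n"
    by (simp flip: power_add)
  then have "(-1 :: int) ^ ?v * ((-1) ^ w * (-1) ^ w) = (-1) ^ ?n * (-1) ^ w"
    by (simp only: flip: mult.assoc)
  moreover have "(-1 :: int) ^ w * (-1) ^ w = 1"
    by (simp flip: power_mult_distrib)
  ultimately have sign: "(-1 :: int) ^ ?v = (-1) ^ ?n * (-1) ^ w"
    by simp
  show ?thesis
    using wt_count_weight_2[OF assms(1,2), of w] wt_count_weight_2[OF assms(1,2) v] assms(3,4)
    by (simp only: choose sign) (simp add: algebra_simps)
qed

text \<open>The classes sort the syndromes off the arc by their number of bisecants. They are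
  nonempty because every \<open>i j\<close> is attained, and disjoint because \<open>i\<close> and
  \<open>fiber\<close> are injective.\<close>

lemma weight_2_cosets:
  assumes i: "bij_betw i {1..m} {k. k > 0 \<and> bisecant_count A k \<noteq> 0}"
  defines "K \<equiv> \<lambda>j. fiber ` {s. s \<noteq> 0 \<and> vec.span {s} \<notin> A \<and> cover 2 s = i j}"
  shows "partition_on (cosets_of_weight 2 (fiber 0)) (K ` {1..m})" "inj_on K {1..m}"
proof -
  have ne: "K j \<noteq> {}" if "j \<in> {1..m}" for j
  proof -
    have "bisecant_count A (i j) \<noteq> 0"
      using bij_betwE[OF i] that by blast
    then show ?thesis
      unfolding K_def bisecant_count_nz_iff by blast
  qed
  have disj: "K j \<inter> K k = {}" if "j \<in> {1..m}" "k \<in> {1..m}" "j \<noteq> k" for j k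
  proof -
    have "i j \<noteq> i k"
      using i that by (auto simp: bij_betw_def inj_on_def)
    then show ?thesis
      using inj_fiber by (auto simp: K_def dest: injD)
  qed
  \<comment> \<open>Two equal classes with different indices would be disjoint from themselves,
    hence empty.\<close>
  show inj: "inj_on K {1..m}"
  proof (rule inj_onI, rule ccontr)
    fix j k assume "j \<in> {1..m}" "k \<in> {1..m}" "K j = K k" "j \<noteq> k"
    then show False using ne[of j] disj[of j k] by simp
  qed
  have "cosets_of_weight 2 (fiber 0) = fiber ` {s. s \<noteq> 0 \<and> vec.span {s} \<notin> A \<and> cover 2 s \<noteq> 0}"
    unfolding cosets_of_weight_fiber
    by (rule arg_cong[of _ _ "image fiber"]) (auto simp: coset_weight_fiber split: if_splits)
  also have "{s. s \<noteq> 0 \<and> vec.span {s} \<notin> A \<and> cover 2 s \<noteq> 0}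
      = (\<Union>j\<in>{1..m}. {s. s \<noteq> 0 \<and> vec.span {s} \<notin> A \<and> cover 2 s = i j})"
  proof (rule Set.set_eqI)
    fix s
    have "cover 2 s \<noteq> 0 \<longleftrightarrow> (\<exists>j\<in>{1..m}. cover 2 s = i j)" if "s \<noteq> 0" "vec.span {s} \<notin> A"
    proof -
      \<comment> \<open>The syndrome \<open>s\<close> itself witnesses that its number of bisecants
        is attained, so a positive number is one of the listed values.\<close>
      have "bisecant_count A (cover 2 s) \<noteq> 0"
        unfolding bisecant_count_nz_iff using that by blast
      then have "cover 2 s \<noteq> 0 \<longleftrightarrow> cover 2 s \<in> i ` {1..m}"
        using bij_betw_imp_surj_on[OF i] by simp
      then show ?thesis by (simp only: image_iff)
    qed
    then show "s \<in> {s. s \<noteq> 0 \<and> vec.span {s} \<notin> A \<and> cover 2 s \<noteq> 0} \<longleftrightarrow>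
        s \<in> (\<Union>j\<in>{1..m}. {s. s \<noteq> 0 \<and> vec.span {s} \<notin> A \<and> cover 2 s = i j})"
      by blast
  qed
  finally have "cosets_of_weight 2 (fiber 0) = \<Union> (K ` {1..m})"
    by (simp only: image_UN K_def)
  moreover have "disjoint (K ` {1..m})"
    unfolding disjoint_def using disj by blast
  moreover have "{} \<notin> K ` {1..m}"
    using ne by force
  ultimately show "partition_on (cosets_of_weight 2 (fiber 0)) (K ` {1..m})"
    by (intro partition_onI) (auto simp: disjoint_def pairwise_def)
qed

lemma weight_3_cosets_eq:
  "cosets_of_weight 3 (fiber 0) = fiber ` {s. s \<noteq> 0 \<and> vec.span {s} \<notin> A \<and> cover 2 s = 0}"
  unfolding cosets_of_weight_fiber
  by (rule arg_cong[of _ _ "image fiber"]) (auto simp: coset_weight_fiber split: if_splits)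

lemma weight_3_distribution:
  assumes "V \<in> cosets_of_weight 3 (fiber 0)"
  shows "wt_count 0 V = 0 \<and> wt_count 1 V = 0 \<and> wt_count 2 V = 0 \<and>
    wt_count 3 V = int (CARD('n) choose 3) \<and>
    (\<forall>w\<in>{4..CARD('n)}. wt_count w V = wt_count w (fiber 0) - Omega 0 w (CARD('n)) 4)"
proof -
  obtain s where s: "V = fiber s" "s \<noteq> 0" "vec.span {s} \<notin> A" "cover 2 s = 0"
    using assms unfolding weight_3_cosets_eq by blast
  then show ?thesis
    using wt_count_fiber_small[OF s(2)] wt_count_fiber_Omega[OF s(2)] cover_1[OF s(2)] by simp
qed

end

section \<open>Transfer to a code that corresponds to the arc\<close>

theorem theorem6p3:
  fixes A :: "('a::{field,finite} ^ 3) set set"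
    and C :: "('a ^ 'n) set"
    and n q m :: nat
    and i :: "nat \<Rightarrow> nat"
  assumes q: "q = CARD('a)"
    and arc: "pg_arc n A"
    and m: "m \<ge> 1"
    and i: "bij_betw i {1..m} {k. k > 0 \<and> bisecant_count A k \<noteq> 0}"
    and C: "MDS_code n (n - 3) 4 C"
    and corr: "code_corresponds_to_arc C A"
  shows
    "(card (cosets_of_weight 1 C) = n * (q - 1) \<and>
      (\<forall>V\<in>cosets_of_weight 1 C.
         wt_count 0 V = 0 \<and> wt_count 2 V = 0 \<and> wt_count 1 V = 1 \<and>
         wt_count 3 V = int ((n - 1) choose 3) \<and>
         (\<forall>w\<in>{4..n}. wt_count w V = wt_count w C - Omega 0 w n 4 + Omega 1 w n 4)))
     \<and>
     (\<exists>K :: nat \<Rightarrow> ('a ^ 'n) set set.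
        partition_on (cosets_of_weight 2 C) (K ` {1..m}) \<and> inj_on K {1..m} \<and>
        (\<forall>j\<in>{1..m}.
           card (K j) = (q - 1) * bisecant_count A (i j) \<and>
           (\<forall>V\<in>K j.
              wt_count 0 V = 0 \<and> wt_count 1 V = 0 \<and> wt_count 2 V = int (i j) \<and>
              (\<forall>w\<in>{3..n}. wt_count w V =
                 wt_count w C - Omega 0 w n 4
                   + (-1) ^ w * int ((n - 2) choose (n - w)) * int (i j)))) \<and>
        (m > 1 \<longrightarrow>
           (\<forall>a\<in>{1..m}. \<forall>b\<in>{1..m}. a \<noteq> b \<longrightarrow>
              (\<forall>Va\<in>K a. \<forall>Vb\<in>K b. \<forall>w\<in>{3..n}.
                 (-1) ^ n * wt_count w Va - wt_count (n + 2 - w) Va =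
                 (-1) ^ n * wt_count w Vb - wt_count (n + 2 - w) Vb))))
     \<and>
     (bisecant_count A 0 = 0 \<longrightarrow>
        pg_complete_arc n A \<and> covering_radius C = 2 \<and> cosets_of_weight 3 C = {})
     \<and>
     (bisecant_count A 0 \<noteq> 0 \<longrightarrow>
        \<not> pg_complete_arc n A \<and> covering_radius C = 3 \<and>
        card (cosets_of_weight 3 C) = (q - 1) * bisecant_count A 0 \<and>
        (\<forall>V\<in>cosets_of_weight 3 C.
           wt_count 0 V = 0 \<and> wt_count 1 V = 0 \<and> wt_count 2 V = 0 \<and>
           wt_count 3 V = int (n choose 3) \<and>
           (\<forall>w\<in>{4..n}. wt_count w V = wt_count w C - Omega 0 w n 4)))"
proof -
  \<comment> \<open>With truncated subtraction the second equation fails for \<open>n < 3\<close>,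
    so it forces \<open>3 \<le> n\<close>.\<close>
  have n: "CARD('n) = n" and "4 = n - (n - 3) + 1"
    using C by (simp_all add: MDS_code_def linear_code_def)
  then have n3: "3 \<le> n" by simp
  obtain H :: "'a ^ 'n ^ 3" where H: "C = {x. H *v x = 0}"
      "bij_betw (\<lambda>j. vec.span {column j H}) UNIV A"
    using corr by (auto simp: code_corresponds_to_arc_def)
  interpret arc_matrix H A
    by unfold_locales (use arc n n3 H in simp_all)
  have C_fiber: "C = fiber 0" by (simp add: H(1) fiber_def)
  define K where "K = (\<lambda>j. fiber ` {s. s \<noteq> 0 \<and> vec.span {s} \<notin> A \<and> cover 2 s = i j})"
  have part: "partition_on (cosets_of_weight 2 C) (K ` {1..m})" and inj: "inj_on K {1..m}"
    using weight_2_cosets[OF i] by (simp_all only: K_def C_fiber)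
  have K_elem: "\<exists>s. V = fiber s \<and> s \<noteq> 0 \<and> vec.span {s} \<notin> A \<and> cover 2 s = i j" if "V \<in> K j" for V j
    using that by (auto simp: K_def)
  have K_card: "card (K j) = (q - 1) * bisecant_count A (i j)" for j
    by (simp only: K_def card_fiber_image card_syndromes_off_arc q)
  have K_dist: "wt_count 0 V = 0 \<and> wt_count 1 V = 0 \<and> wt_count 2 V = int (i j) \<and>
      (\<forall>w\<in>{3..n}. wt_count w V = wt_count w C - Omega 0 w n 4
         + (-1) ^ w * int ((n - 2) choose (n - w)) * int (i j))" if V: "V \<in> K j" for V j
  proof -
    obtain s where s: "V = fiber s" "s \<noteq> 0" "vec.span {s} \<notin> A" "cover 2 s = i j"
      using K_elem[OF V] by blast
    show ?thesis
      using wt_count_fiber_small[OF s(2)] cover_1[OF s(2)] wt_count_weight_2[OF s(2,3)] s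
      by (simp add: C_fiber n)
  qed
  have K_sym: "(-1) ^ n * wt_count w Va - wt_count (n + 2 - w) Va =
      (-1) ^ n * wt_count w Vb - wt_count (n + 2 - w) Vb"
    if V: "Va \<in> K a" "Vb \<in> K b" and w: "w \<in> {3..n}" for Va Vb a b w
  proof -
    obtain s t where "Va = fiber s" "s \<noteq> 0" "vec.span {s} \<notin> A"
        "Vb = fiber t" "t \<noteq> 0" "vec.span {t} \<notin> A"
      using K_elem[OF V(1)] K_elem[OF V(2)] by blast
    then show ?thesis
      using wt_count_symmetric_difference[of s w] wt_count_symmetric_difference[of t w] w
      by (simp add: n)
  qed
  \<comment> \<open>Since \<open>m\<close> is positive, some syndrome off the arc lies on a
    bisecant. Its coset of weight 2 shows that the covering radius is at least 2.\<close>
  have "i 1 > 0 \<and> bisecant_count A (i 1) \<noteq> 0"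
    using bij_betwE[OF i] m by force
  then obtain s2 where "s2 \<noteq> 0" "vec.span {s2} \<notin> A" "cover 2 s2 \<noteq> 0"
    using bisecant_count_nz_iff by auto
  then have s2: "coset_weight (fiber s2) = 2"
    by (simp add: coset_weight_fiber)
  show ?thesis
  proof (rule conjI, goal_cases)
    case 1
    show ?case
      using weight_1_cosets unfolding C_fiber n q .
  next
    case 2
    have "pg_complete_arc n A \<and> covering_radius C = 2 \<and> cosets_of_weight 3 C = {}"
      if c0: "bisecant_count A 0 = 0"
    proof -
      have no3: "{s. s \<noteq> 0 \<and> vec.span {s} \<notin> A \<and> cover 2 s = 0} = {}"
        using c0 bisecant_count_nz_iff[of 0] by blast
      then have "coset_weight (fiber s) \<le> 2" for s
        using coset_weight_fiber[of s] by auto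
      then have "covering_radius C = 2"
        unfolding C_fiber using s2 by (rule covering_radius_eqI)
      moreover have "cosets_of_weight 3 C = {}"
        unfolding C_fiber weight_3_cosets_eq no3 by simp
      ultimately show ?thesis
        using pg_complete_arc_iff[OF assms(2)] c0 by blast
    qed
    moreover have "\<not> pg_complete_arc n A \<and> covering_radius C = 3 \<and>
        card (cosets_of_weight 3 C) = (q - 1) * bisecant_count A 0 \<and>
        (\<forall>V\<in>cosets_of_weight 3 C.
           wt_count 0 V = 0 \<and> wt_count 1 V = 0 \<and> wt_count 2 V = 0 \<and>
           wt_count 3 V = int (n choose 3) \<and>
           (\<forall>w\<in>{4..n}. wt_count w V = wt_count w C - Omega 0 w n 4))"
      if c0: "bisecant_count A 0 \<noteq> 0"
    proof -
      obtain s3 where "s3 \<noteq> 0" "vec.span {s3} \<notin> A" "cover 2 s3 = 0"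
        using c0 bisecant_count_nz_iff[of 0] by blast
      then have "coset_weight (fiber s3) = 3"
        by (simp add: coset_weight_fiber)
      moreover have "coset_weight (fiber s) \<le> 3" for s
        by (simp add: coset_weight_fiber)
      ultimately have "covering_radius C = 3"
        unfolding C_fiber by (intro covering_radius_eqI)
      moreover have "card (cosets_of_weight 3 C) = (q - 1) * bisecant_count A 0"
        by (simp only: C_fiber weight_3_cosets_eq card_fiber_image card_syndromes_off_arc q)
      ultimately show ?thesis
        using pg_complete_arc_iff[OF assms(2)] c0 weight_3_distribution
        by (simp only: C_fiber n) blast
    qed
    ultimately show ?case
      using part inj K_card K_dist K_sym by blast
  qed
qed

end
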